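(* Let $\sigma=\{R\}$ with $R$ binary, and let $\Phi=\mathsf{Split}\vee\mathsf{Diverse}$ be the fluted sentence defined in the context. Over finite structures, $\Phi$ is preserved under extensions (if $\mathfrak C\subseteq\mathfrak D$ are finite $\sigma$-structures and $\mathfrak C\models\Phi$, then $\mathfrak D\models\Phi$), but there is no existential fluted sentence $\psi\in\exists\mathsf{FL}[0](\sigma)$ that has the same truth value as $\Phi$ in every finite $\sigma$-structure.
   Context: All structures have non-empty domains; there is no equality in the language. $\mathfrak C\subseteq\mathfrak D$ means that $\mathfrak C$ is the induced substructure of $\mathfrak D$ on $C\subseteq D$; then $\mathfrak D$ is an extension of $\mathfrak C$. Existential fluted formulas. Fix variables $x_1,x_2,\ldots$. The existential levels $\exists\mathsf{FL}[m](\sigma)$, $m\ge0$, are defined by simultaneous induction: $\top,\bot\in\exists\mathsf{FL}[m](\sigma)$; for $R\in\sigma$ of arity $r\le m$, the suffix atom $R(x_{m-r+1},\ldots,x_m)$ and its negation are in $\exists\mathsf{FL}[m](\sigma)$; closure under $\wedge$ and $\vee$; if $\varphi\in\exists\mathsf{FL}[m+1](\sigma)$ then $\exists x_{m+1}\varphi\in\exists\mathsf{FL}[m](\sigma)$. There are no universal quantifiers. $\exists\mathsf{FL}[0](\sigma)$ is the set of existential fluted sentences. The sentence $\Phi$. Let $\mathsf Z(x_2):=\forall x_3\,\neg R(x_2,x_3)$, $\mathsf O(x_2):=\forall x_3\,R(x_2,x_3)$, $\mathsf M(x_2):=\exists x_3 R(x_2,x_3)\wedge\exists x_3\neg R(x_2,x_3)$,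 and $\mathsf M(x_1):=\exists x_2R(x_1,x_2)\wedge\exists x_2\neg R(x_1,x_2)$. For $\varepsilon\in\{0,1\}$ let $R^{1}(x_1,x_2):=R(x_1,x_2)$, $R^{0}(x_1,x_2):=\neg R(x_1,x_2)$, and for $T\in\{\mathsf Z,\mathsf O,\mathsf M\}$ let $E_{\varepsilon,T}(x_1):=\exists x_2(R^{\varepsilon}(x_1,x_2)\wedge T(x_2))$. Put $$\mathsf{Split}:=\bigvee_{T\in\{\mathsf Z,\mathsf O,\mathsf M\}}\exists x_1(E_{0,T}(x_1)\wedge E_{1,T}(x_1)),$$ $$\mathsf{Diverse}:=\bigvee_{\varepsilon\in\{0,1\},\,T\in\{\mathsf Z,\mathsf O,\mathsf M\}}\bigl[\exists x_1(\mathsf M(x_1)\wedge E_{\varepsilon,T}(x_1))\wedge\exists x_1(\mathsf M(x_1)\wedge\neg E_{\varepsilon,T}(x_1))\bigr],$$ $$\Phi:=\mathsf{Split}\vee\mathsf{Diverse}.$$ *)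

theory Defs
  imports Main
begin

text \<open>
  First-order logic without equality. A relational signature is a type \<open>'r\<close> of relation symbols
  together with an arity function \<open>ar\<close>; the number \<open>i\<close> stands for the variable \<open>x\<^sub>i\<close>.
\<close>

datatype 'r fm =
    Top
  | Bot
  | Atom 'r "nat list"
  | Neg "'r fm"
  | And "'r fm" "'r fm"
  | Or "'r fm" "'r fm"
  | Ex nat "'r fm"
  | All nat "'r fm"

fun disjs :: "'r fm list \<Rightarrow> 'r fm" where
  "disjs [] = Bot"
| "disjs (\<phi> # \<phi>s) = Or \<phi> (disjs \<phi>s)"

record ('a, 'r) rel_struct =
  dom :: "'a set"
  interp :: "'r \<Rightarrow> 'a list set"

definition is_struct :: "('r \<Rightarrow> nat) \<Rightarrow> ('a, 'r) rel_struct \<Rightarrow> bool" where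
  "is_struct ar A \<longleftrightarrow>
     dom A \<noteq> {} \<and> (\<forall>r. interp A r \<subseteq> {t. length t = ar r \<and> set t \<subseteq> dom A})"

definition finite_struct :: "('r \<Rightarrow> nat) \<Rightarrow> ('a, 'r) rel_struct \<Rightarrow> bool" where
  "finite_struct ar A \<longleftrightarrow> is_struct ar A \<and> finite (dom A)"

definition induced_substruct :: "('a, 'r) rel_struct \<Rightarrow> ('a, 'r) rel_struct \<Rightarrow> bool" where
  "induced_substruct C D \<longleftrightarrow>
     dom C \<subseteq> dom D \<and> (\<forall>r. interp C r = {t \<in> interp D r. set t \<subseteq> dom C})"

fun sat :: "('a, 'r) rel_struct \<Rightarrow> (nat \<Rightarrow> 'a) \<Rightarrow> 'r fm \<Rightarrow> bool" where
  "sat A v Top \<longleftrightarrow> True"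
| "sat A v Bot \<longleftrightarrow> False"
| "sat A v (Atom r is) \<longleftrightarrow> map v is \<in> interp A r"
| "sat A v (Neg \<phi>) \<longleftrightarrow> \<not> sat A v \<phi>"
| "sat A v (And \<phi> \<psi>) \<longleftrightarrow> sat A v \<phi> \<and> sat A v \<psi>"
| "sat A v (Or \<phi> \<psi>) \<longleftrightarrow> sat A v \<phi> \<or> sat A v \<psi>"
| "sat A v (Ex i \<phi>) \<longleftrightarrow> (\<exists>a\<in>dom A. sat A (v(i := a)) \<phi>)"
| "sat A v (All i \<phi>) \<longleftrightarrow> (\<forall>a\<in>dom A. sat A (v(i := a)) \<phi>)"

text \<open>Only used for sentences, whose truth value does not depend on the assignment.\<close>

definition models :: "('a, 'r) rel_struct \<Rightarrow> 'r fm \<Rightarrow> bool" where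
  "models A \<phi> \<longleftrightarrow> (\<forall>v. range v \<subseteq> dom A \<longrightarrow> sat A v \<phi>)"

text \<open>
  \<open>EFL ar m\<close> is the level \<open>m\<close> of the existential fluted fragment. For \<open>ar r \<le> m\<close> the list
  \<open>[m - ar r + 1..<m + 1]\<close> is the suffix of length \<open>ar r\<close> of \<open>x\<^sub>1, \<dots>, x\<^sub>m\<close> (it is empty if
  \<open>ar r = 0\<close>).
\<close>

inductive EFL :: "('r \<Rightarrow> nat) \<Rightarrow> nat \<Rightarrow> 'r fm \<Rightarrow> bool"
  for ar :: "'r \<Rightarrow> nat"
where
  Top: "EFL ar m Top"
| Bot: "EFL ar m Bot"
| Atom: "ar r \<le> m \<Longrightarrow> EFL ar m (Atom r [m - ar r + 1..<m + 1])"
| NegAtom: "ar r \<le> m \<Longrightarrow> EFL ar m (Neg (Atom r [m - ar r + 1..<m + 1]))"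
| And: "EFL ar m \<phi> \<Longrightarrow> EFL ar m \<psi> \<Longrightarrow> EFL ar m (And \<phi> \<psi>)"
| Or: "EFL ar m \<phi> \<Longrightarrow> EFL ar m \<psi> \<Longrightarrow> EFL ar m (Or \<phi> \<psi>)"
| Ex: "EFL ar (m + 1) \<phi> \<Longrightarrow> EFL ar m (Ex (m + 1) \<phi>)"

datatype sym = RSym

fun sym_arity :: "sym \<Rightarrow> nat" where
  "sym_arity RSym = 2"

definition R_atom :: "nat \<Rightarrow> nat \<Rightarrow> sym fm" where
  "R_atom i j = Atom RSym [i, j]"

definition Z_x2 :: "sym fm" where
  "Z_x2 = All 3 (Neg (R_atom 2 3))"

definition O_x2 :: "sym fm" where
  "O_x2 = All 3 (R_atom 2 3)"

definition M_x2 :: "sym fm" where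
  "M_x2 = And (Ex 3 (R_atom 2 3)) (Ex 3 (Neg (R_atom 2 3)))"

definition M_x1 :: "sym fm" where
  "M_x1 = And (Ex 2 (R_atom 1 2)) (Ex 2 (Neg (R_atom 1 2)))"

definition R_signed :: "bool \<Rightarrow> sym fm" where
  "R_signed \<epsilon> = (if \<epsilon> then R_atom 1 2 else Neg (R_atom 1 2))"

definition E_x1 :: "bool \<Rightarrow> sym fm \<Rightarrow> sym fm" where
  "E_x1 \<epsilon> T = Ex 2 (And (R_signed \<epsilon>) T)"

definition Split :: "sym fm" where
  "Split = disjs [Ex 1 (And (E_x1 False T) (E_x1 True T)). T \<leftarrow> [Z_x2, O_x2, M_x2]]"

definition Diverse :: "sym fm" where
  "Diverse =
     disjs [And (Ex 1 (And M_x1 (E_x1 \<epsilon> T))) (Ex 1 (And M_x1 (Neg (E_x1 \<epsilon> T)))).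
       \<epsilon> \<leftarrow> [False, True], T \<leftarrow> [Z_x2, O_x2, M_x2]]"

definition Phi :: "sym fm" where
  "Phi = Or Split Diverse"

end

theory Submission
  imports Defs
begin

text \<open>
  Call an element constant if its row in the matrix of \<open>R\<close> is constant, and mixed otherwise; this
  gives three classes \<open>Z\<close>, \<open>O\<close>, \<open>M\<close>. The sentence \<open>\<Phi>\<close> fails exactly when \<open>R(x, y)\<close> depends only
  on the classes of \<open>x\<close> and \<open>y\<close>, or equivalently when some labelling of the elements by three labels,
  two of them forcing a constant row, determines \<open>R\<close>. Such a labelling restricts to substructures.
  For inexpressibility, existential fluted sentences are preserved along simulations that respect
  both \<open>R\<close> and its complement, because a fluted formula of level \<open>m\<close> only sees \<open>x\<^sub>m\<^sub>-\<^sub>1\<close> and \<open>x\<^sub>m\<close>. The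
  structure on \<open>{0, 1, 2}\<close> with the single edge \<open>(0, 2)\<close> satisfies \<open>\<Phi>\<close> and is simulated by the one
  on \<open>{0, 1}\<close> with the single edge \<open>(0, 1)\<close>, where \<open>\<Phi>\<close> fails.
\<close>

definition edge :: "('a, sym) rel_struct \<Rightarrow> 'a \<Rightarrow> 'a \<Rightarrow> bool" where
  "edge A x y \<longleftrightarrow> [x, y] \<in> interp A RSym"

text \<open>\<open>Some False\<close>, \<open>Some True\<close> and \<open>None\<close> encode \<open>Z\<close>, \<open>O\<close> and \<open>M\<close>.\<close>

definition row_class :: "('a, sym) rel_struct \<Rightarrow> 'a \<Rightarrow> bool option" where
  "row_class A x =
     (if \<forall>y\<in>dom A. \<not> edge A x y then Some False
      else if \<forall>y\<in>dom A. edge A x y then Some True else None)"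

definition sees :: "('a, sym) rel_struct \<Rightarrow> bool \<Rightarrow> bool option \<Rightarrow> 'a \<Rightarrow> bool" where
  "sees A \<epsilon> c x \<longleftrightarrow> (\<exists>y\<in>dom A. edge A x y = \<epsilon> \<and> row_class A y = c)"

lemma ex_row_class: "(\<exists>c :: bool option. P c) \<longleftrightarrow> P (Some False) \<or> P (Some True) \<or> P None"
  by (metis option.exhaust)

lemma sat_row_class:
  assumes "dom A \<noteq> {}"
  shows "sat A v Z_x2 \<longleftrightarrow> row_class A (v 2) = Some False"
    and "sat A v O_x2 \<longleftrightarrow> row_class A (v 2) = Some True"
    and "sat A v M_x2 \<longleftrightarrow> row_class A (v 2) = None"
    and "sat A v M_x1 \<longleftrightarrow> row_class A (v 1) = None"
  using assms
  by (auto simp: Z_x2_def O_x2_def M_x2_def M_x1_def R_atom_def row_class_def edge_def)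

lemma sat_E_x1:
  assumes "dom A \<noteq> {}"
  shows "sat A v (E_x1 \<epsilon> Z_x2) \<longleftrightarrow> sees A \<epsilon> (Some False) (v 1)"
    and "sat A v (E_x1 \<epsilon> O_x2) \<longleftrightarrow> sees A \<epsilon> (Some True) (v 1)"
    and "sat A v (E_x1 \<epsilon> M_x2) \<longleftrightarrow> sees A \<epsilon> None (v 1)"
  using assms
  by (auto simp: sat_row_class E_x1_def R_signed_def R_atom_def sees_def edge_def)

lemma sat_Split:
  assumes "dom A \<noteq> {}"
  shows "sat A v Split \<longleftrightarrow> (\<exists>c. \<exists>x\<in>dom A. sees A False c x \<and> sees A True c x)"
  unfolding ex_row_class using assms by (simp add: Split_def sat_E_x1)

lemma sat_Diverse:
  assumes "dom A \<noteq> {}"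
  shows "sat A v Diverse \<longleftrightarrow>
    (\<exists>\<epsilon> c. (\<exists>x\<in>dom A. row_class A x = None \<and> sees A \<epsilon> c x) \<and>
           (\<exists>x\<in>dom A. row_class A x = None \<and> \<not> sees A \<epsilon> c x))"
  unfolding ex_row_class ex_bool_eq using assms
  by (simp add: Diverse_def sat_E_x1 sat_row_class) argo

text \<open>\<open>b\<close> is the common row of the elements labelled \<open>None\<close>, read
  off at the label of the target. Nothing ties \<open>t\<close> to the actual row classes, so the
  condition is purely universal.\<close>

definition labelled ::
    "('a, sym) rel_struct \<Rightarrow> ('a \<Rightarrow> bool option) \<Rightarrow> (bool option \<Rightarrow> bool) \<Rightarrow> bool" where
  "labelled A t b \<longleftrightarrow> (\<forall>x\<in>dom A. \<forall>y\<in>dom A.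
     edge A x y = (case t x of Some \<epsilon> \<Rightarrow> \<epsilon> | None \<Rightarrow> b (t y)))"

text \<open>Failure of \<open>Split\<close> makes \<open>edge A x y\<close> depend only on
  \<open>x\<close> and the class of \<open>y\<close>; failure of \<open>Diverse\<close> makes the
  dependence the same for all mixed \<open>x\<close>.\<close>

lemma not_Phi_imp_labelled:
  assumes "dom A \<noteq> {}" "\<not> sat A v Phi"
  shows "labelled A (row_class A) (\<lambda>c. \<exists>x\<in>dom A. row_class A x = None \<and> sees A True c x)"
proof -
  have split: "sees A True c x \<Longrightarrow> x \<in> dom A \<Longrightarrow> \<not> sees A False c x" for c x
    using assms by (auto simp: Phi_def sat_Split)
  have diverse: "sees A \<epsilon> c x \<longleftrightarrow> sees A \<epsilon> c x'"
    if "x \<in> dom A" "x' \<in> dom A" "row_class A x = None" "row_class A x' = None" for \<epsilon> c x x'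
    using that assms unfolding Phi_def sat.simps sat_Diverse[OF assms(1)] by blast
  show ?thesis
    unfolding labelled_def
  proof (intro ballI)
    fix x y assume xy: "x \<in> dom A" "y \<in> dom A"
    have see: "sees A (edge A x y) (row_class A y) x"
      using xy by (auto simp: sees_def)
    show "edge A x y = (case row_class A x of Some \<epsilon> \<Rightarrow> \<epsilon>
      | None \<Rightarrow> \<exists>x\<in>dom A. row_class A x = None \<and> sees A True (row_class A y) x)"
    proof (cases "row_class A x")
      case None
      have "edge A x y \<longleftrightarrow> sees A True (row_class A y) x"
        using see split xy by metis
      then show ?thesis unfolding None option.case using None diverse xy(1) by blast
    next
      case (Some \<epsilon>)
      then show ?thesis using xy by (auto simp: row_class_def split: if_splits)
    qed
  qed
qed

text \<open>
  The labelling need not be the one by row classes: if the elements labelled \<open>None\<close> happen to have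
  constant rows, then no element is mixed.
\<close>

lemma labelled_imp_not_Phi:
  assumes "dom A \<noteq> {}" and lab: "labelled A t b"
  shows "\<not> sat A v Phi"
proof -
  have e: "edge A x y = (case t x of Some \<epsilon> \<Rightarrow> \<epsilon> | None \<Rightarrow> b (t y))"
    if "x \<in> dom A" "y \<in> dom A" for x y
    using lab that by (simp add: labelled_def)
  have mixed: "t x = None" if "x \<in> dom A" "row_class A x = None" for x
    using that by (cases "t x") (auto simp: row_class_def e split: if_splits)
  have same_row: "row_class A x = row_class A y" if "x \<in> dom A" "y \<in> dom A" "t x = t y" for x y
    using that by (simp add: row_class_def e cong: ball_cong)
  \<comment> \<open>The mixed \<open>m\<close> is labelled \<open>None\<close>, so all elements
    labelled \<open>None\<close> share its row and are mixed; any other element has the constant row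
    named by its label.\<close>
  have row: "row_class A x = t x"
    if m: "m \<in> dom A" "row_class A m = None" and "x \<in> dom A" for m x
    using that mixed[OF m] same_row[of x m] assms(1)
    by (cases "t x") (auto simp: row_class_def e)
  have split: False
    if "x \<in> dom A" "y \<in> dom A" "z \<in> dom A" "row_class A y = row_class A z"
      "\<not> edge A x y" "edge A x z" for x y z
  proof -
    \<comment> \<open>Having both an edge and a non-edge makes \<open>x\<close> mixed, so
      \<open>row\<close> applies and turns equal classes into equal labels.\<close>
    have "row_class A x = None"
      using that by (auto simp: row_class_def)
    then have "t y = t z"
      using that row by metis
    then show False
      using that by (simp add: e split: option.splits)
  qed
  have diverse: "sees A \<epsilon> c x \<longleftrightarrow> sees A \<epsilon> c x'"
    if "x \<in> dom A" "x' \<in> dom A" "row_class A x = None" "row_class A x' = None" for \<epsilon> c x x'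
    using that mixed by (auto simp: sees_def e)
  have "\<not> sat A v Split"
    unfolding sat_Split[OF assms(1)] sees_def using split by metis
  moreover have "\<not> sat A v Diverse"
    unfolding sat_Diverse[OF assms(1)] using diverse by metis
  ultimately show ?thesis
    by (simp add: Phi_def)
qed

lemma models_Phi_iff:
  assumes "dom A \<noteq> {}"
  shows "models A Phi \<longleftrightarrow> (\<nexists>t b. labelled A t b)"
proof -
  from assms obtain a where a: "a \<in> dom A" by blast
  have "sat A v Phi \<longleftrightarrow> (\<nexists>t b. labelled A t b)" for v
    using not_Phi_imp_labelled labelled_imp_not_Phi assms by metis
  moreover have "range (\<lambda>_ :: nat. a) \<subseteq> dom A" using a by auto
  ultimately show ?thesis unfolding models_def by blast
qed

lemma labelled_substruct:
  assumes "induced_substruct C D" "labelled D t b"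
  shows "labelled C t b"
  using assms by (auto simp: labelled_def induced_substruct_def edge_def subset_iff)

definition simulation ::
    "('a, sym) rel_struct \<Rightarrow> ('b, sym) rel_struct \<Rightarrow> ('a \<Rightarrow> 'b \<Rightarrow> bool) \<Rightarrow> bool" where
  "simulation A B S \<longleftrightarrow>
     (\<forall>a\<in>dom A. \<exists>b\<in>dom B. S a b) \<and>
     (\<forall>a b. S a b \<longrightarrow> (\<forall>a'\<in>dom A. \<exists>b'\<in>dom B. S a' b' \<and> edge A a a' = edge B b b'))"

text \<open>Induction on the formula. Atoms of level \<open>m\<close> mention only the last two
  variables, so the invariant concerns only these; edges must agree in both directions because of
  negated atoms.\<close>

lemma EFL_simulation:
  assumes "simulation A B S" "EFL sym_arity m \<phi>" "sat A v \<phi>"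
    and "1 \<le> m \<Longrightarrow> S (v m) (w m)"
    and "2 \<le> m \<Longrightarrow> edge A (v (m - 1)) (v m) = edge B (w (m - 1)) (w m)"
  shows "sat B w \<phi>"
  using assms(2-)
proof (induction arbitrary: v w rule: EFL.induct)
  case (Atom r m)
  have "[m - 1..<Suc m] = [m - 1, m]"
    using Atom by (cases r) (simp add: upt_conv_Cons)
  with Atom show ?case
    by (cases r) (simp add: edge_def Suc_diff_Suc numeral_2_eq_2)
next
  case (NegAtom r m)
  have "[m - 1..<Suc m] = [m - 1, m]"
    using NegAtom by (cases r) (simp add: upt_conv_Cons)
  with NegAtom show ?case
    by (cases r) (simp add: edge_def Suc_diff_Suc numeral_2_eq_2)
next
  case (Ex m \<phi>)
  then obtain a where a: "a \<in> dom A" "sat A (v(m + 1 := a)) \<phi>" by auto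
  \<comment> \<open>For \<open>m = 0\<close> there is no previous element, and the first clause of
    \<open>simulation\<close> supplies \<open>b\<close>.\<close>
  have "\<exists>b\<in>dom B. S a b \<and> (1 \<le> m \<longrightarrow> edge A (v m) a = edge B (w m) b)"
    using assms(1) a(1) Ex.prems(2) unfolding simulation_def by (cases "1 \<le> m") auto
  then obtain b where b: "b \<in> dom B" "S a b" "1 \<le> m \<Longrightarrow> edge A (v m) a = edge B (w m) b"
    by auto
  have "sat B (w(m + 1 := b)) \<phi>"
    using b by (intro Ex.IH[OF a(2)]) auto
  with b(1) show ?case by auto
qed auto

lemma models_simulation:
  assumes "simulation A B S" "EFL sym_arity 0 \<phi>" "models A \<phi>" "dom A \<noteq> {}"
  shows "models B \<phi>"
proof -
  from assms(4) obtain a where a: "a \<in> dom A" by blast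
  then have "sat A (\<lambda>_. a) \<phi>"
    using assms(3) by (auto simp: models_def)
  then show ?thesis
    using EFL_simulation[OF assms(1,2)] by (auto simp: models_def)
qed

definition one_edge :: "nat \<Rightarrow> (nat, sym) rel_struct" where
  "one_edge n = \<lparr>dom = {0..n}, interp = (\<lambda>_. {[0, n]})\<rparr>"

lemma one_edge_simps [simp]:
  "dom (one_edge n) = {0..n}"
  "edge (one_edge n) x y \<longleftrightarrow> x = 0 \<and> y = n"
  by (auto simp: one_edge_def edge_def)

lemma finite_one_edge: "finite_struct sym_arity (one_edge n)"
proof -
  have "sym_arity r = 2" for r by (cases r) simp
  then show ?thesis
    by (auto simp: finite_struct_def is_struct_def one_edge_def)
qed

text \<open>
  Here \<open>0\<close> simulates everything: it reaches itself along a non-edge, which answers all moves of the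
  elements with no outgoing edge.
\<close>

lemma simulation_one_edge:
  "simulation (one_edge 2) (one_edge 1) (\<lambda>a b. b = 0 \<or> b = 1 \<and> a \<noteq> 0)"
proof -
  have "{0..2} = {0, 1, 2 :: nat}" "{0..1} = {0, 1 :: nat}" by auto
  then show ?thesis by (auto simp: simulation_def)
qed

lemma Phi_one_edge_2: "models (one_edge 2) Phi"
proof -
  have "\<not> labelled (one_edge 2) t b" for t b
  proof
    assume "labelled (one_edge 2) t b"
    then have e: "(x = 0 \<and> y = 2) = (case t x of Some \<epsilon> \<Rightarrow> \<epsilon> | None \<Rightarrow> b (t y))"
      if "x \<le> 2" "y \<le> 2" for x y
      using that by (simp add: labelled_def)
    \<comment> \<open>The mixed row of \<open>0\<close> forces the label \<open>None\<close>. Since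
      \<open>1\<close> and \<open>2\<close> have empty rows and \<open>0\<close> does not, both are
      labelled \<open>Some False\<close>; but \<open>0\<close> has an edge to \<open>2\<close> and
      none to \<open>1\<close>.\<close>
    show False
      using e[of 0 0] e[of 0 1] e[of 0 2] e[of 1 0] e[of 2 0] e[of 1 2] e[of 2 2]
      by (cases "t 0"; cases "t 1"; cases "t 2") auto
  qed
  then show ?thesis by (simp add: models_Phi_iff)
qed

lemma not_Phi_one_edge_1: "\<not> models (one_edge 1) Phi"
proof -
  \<comment> \<open>These are the row classes: \<open>0\<close> is mixed and \<open>1\<close> has an
    empty row. The function on labels is the row of \<open>0\<close>.\<close>
  have "labelled (one_edge 1) (\<lambda>x. if x = 0 then None else Some False) (\<lambda>c. c \<noteq> None)"
    by (auto simp: labelled_def)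
  then show ?thesis by (auto simp: models_Phi_iff)
qed

theorem corollary4p9:
  shows "(\<forall>C D :: ('a, sym) rel_struct.
            finite_struct sym_arity C \<longrightarrow> finite_struct sym_arity D \<longrightarrow>
            induced_substruct C D \<longrightarrow> models C Phi \<longrightarrow> models D Phi)
       \<and> \<not> (\<exists>\<psi>. EFL sym_arity 0 \<psi> \<and> (\<forall>A :: (nat, sym) rel_struct.
            finite_struct sym_arity A \<longrightarrow> (models A \<psi> \<longleftrightarrow> models A Phi)))"
proof (intro conjI allI impI notI)
  fix C D :: "('a, sym) rel_struct"
  assume "finite_struct sym_arity C" "finite_struct sym_arity D"
    and sub: "induced_substruct C D" and "models C Phi"
  moreover from this have "dom C \<noteq> {}" "dom D \<noteq> {}"
    by (auto simp: finite_struct_def is_struct_def)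
  ultimately show "models D Phi"
    using labelled_substruct[OF sub] by (auto simp: models_Phi_iff)
next
  assume "\<exists>\<psi>. EFL sym_arity 0 \<psi> \<and> (\<forall>A :: (nat, sym) rel_struct.
            finite_struct sym_arity A \<longrightarrow> (models A \<psi> \<longleftrightarrow> models A Phi))"
  then obtain \<psi> where \<psi>: "EFL sym_arity 0 \<psi>"
    "\<And>n. models (one_edge n) \<psi> \<longleftrightarrow> models (one_edge n) Phi"
    using finite_one_edge by blast
  then have "models (one_edge 1) \<psi>"
    using models_simulation[OF simulation_one_edge \<psi>(1)] Phi_one_edge_2 by simp
  then show False
    using \<psi>(2) not_Phi_one_edge_1 by blast
qed

end
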